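(* Let $\alpha>0$ and $\theta>0$, and let $f_T(\cdot)=f_T(\cdot;\alpha,\theta)$ be the probability density function of the $\mathrm{LBS}(\alpha,\theta)$ distribution, i.e. $$f_{T}(t)=\frac{1}{\sqrt{2\pi}\,\alpha\,\theta(\alpha^2+2)}\left[\left(\frac{t}{\theta}\right)^{1/2}+\left(\frac{\theta}{t}\right)^{1/2}\right]\exp\left[-\frac{1}{2\alpha^2}\left(\frac{t}{\theta}+\frac{\theta}{t}-2\right)\right],\qquad t>0.$$ Then: 1) if $\alpha\leqslant 2$, then $f_T$ is unimodal, with mode $t_0=\theta$; 2) if $\alpha>2$, then $f_T$ is bimodal, with modes $$t_{\pm}=\frac{\theta}{2}\left[(\alpha^2-2)\pm\alpha\sqrt{(\alpha-2)(\alpha+2)}\right]$$ and with minimum point $t_0=\theta$.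
   Context: The length-biased Birnbaum-Saunders distribution with parameters $\alpha>0$, $\theta>0$, denoted $\mathrm{LBS}(\alpha,\theta)$, is the distribution on $(0,\infty)$ with the density $f_T$ displayed in the claim. A mode of a density on $(0,\infty)$ is a point of local maximum of the density. The density is called unimodal if it has exactly one mode and bimodal if it has exactly two modes. "Minimum point" means a point of local minimum of the density on $(0,\infty)$ (located between the two modes). *)

theory Defs
  imports Complex_Main
begin

(* Density of the length-biased Birnbaum-Saunders distribution LBS(alpha, theta),
   extended by 0 outside its support (0, infinity). *)
definition lbs_density :: "real \<Rightarrow> real \<Rightarrow> real \<Rightarrow> real" where
  "lbs_density \<alpha> \<theta> t =
     (if t > 0
      then 1 / (sqrt (2 * pi) * \<alpha> * \<theta> * (\<alpha>\<^sup>2 + 2))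
             * (sqrt (t / \<theta>) + sqrt (\<theta> / t))
             * exp (- (1 / (2 * \<alpha>\<^sup>2)) * (t / \<theta> + \<theta> / t - 2))
      else 0)"

(* Local extrema are meant in the non-strict sense, relative to (0, infinity). *)
definition is_mode :: "(real \<Rightarrow> real) \<Rightarrow> real \<Rightarrow> bool" where
  "is_mode f x \<longleftrightarrow> x \<in> {0<..} \<and> (\<forall>\<^sub>F y in at x within {0<..}. f y \<le> f x)"

definition is_min_point :: "(real \<Rightarrow> real) \<Rightarrow> real \<Rightarrow> bool" where
  "is_min_point f x \<longleftrightarrow> x \<in> {0<..} \<and> (\<forall>\<^sub>F y in at x within {0<..}. f x \<le> f y)"

definition unimodal :: "(real \<Rightarrow> real) \<Rightarrow> bool" where
  "unimodal f \<longleftrightarrow> card {x. is_mode f x} = 1"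

definition bimodal :: "(real \<Rightarrow> real) \<Rightarrow> bool" where
  "bimodal f \<longleftrightarrow> card {x. is_mode f x} = 2"

end

(* With w(t) = sqrt (t / theta) + sqrt (theta / t), the identity w^2 = t / theta + theta / t + 2
   turns the density into a constant multiple of w * exp (- (w^2 - 4) / (2 * alpha^2)), which
   as a function of w > 0 increases up to w = alpha and decreases afterwards. In turn, w decreases
   on (0, theta] down to its minimum w(theta) = 2 and increases from there on. For alpha <= 2 only
   the decreasing branch is met; for alpha > 2 the modes are the two solutions of w(t) = alpha. *)
theory Submission
  imports Defs
begin

section \<open>Local extrema and monotonicity\<close>

text \<open>Lets the criteria for modes below serve for minimum points too.\<close>

lemma is_min_point_iff_is_mode: "is_min_point f x \<longleftrightarrow> is_mode (\<lambda>t. - f t) x"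
  by (simp add: is_min_point_def is_mode_def)

lemma is_mode_peak:
  fixes f :: "real \<Rightarrow> real"
  assumes "0 < x" "a < x" "x < b"
    and incr: "\<And>y. 0 < y \<Longrightarrow> a < y \<Longrightarrow> y < x \<Longrightarrow> f y \<le> f x"
    and decr: "\<And>y. x < y \<Longrightarrow> y < b \<Longrightarrow> f y \<le> f x"
  shows "is_mode f x"
proof -
  have "\<forall>\<^sub>F y in at x within {0<..}. y \<in> {a<..<b}"
    using assms(2,3) by (intro eventually_at_in_open'[THEN filter_leD[OF at_le[OF subset_UNIV]]]) auto
  \<comment> \<open>Positivity comes from the filter itself, so \<open>a\<close> may lie below
    0.\<close>
  moreover have "\<forall>\<^sub>F y in at x within {0<..}. y \<in> {0<..}"
    by (simp add: eventually_at_filter)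
  ultimately have "\<forall>\<^sub>F y in at x within {0<..}. f y \<le> f x"
    by eventually_elim (use incr decr in \<open>metis greaterThanLessThan_iff greaterThan_iff linorder_neqE_linordered_idom order_refl\<close>)
  then show ?thesis
    using assms(1) by (simp add: is_mode_def)
qed

text \<open>Modes are non-strict, so excluding one takes strictly larger values arbitrarily close
  by.\<close>

lemma not_is_mode_increasing:
  fixes f :: "real \<Rightarrow> real"
  assumes "x < b" "\<And>y. x < y \<Longrightarrow> y < b \<Longrightarrow> f x < f y"
  shows "\<not> is_mode f x"
proof
  assume "is_mode f x"
  then have "0 < x" and "\<forall>\<^sub>F y in at x within {0<..}. f y \<le> f x"
    by (auto simp: is_mode_def)
  then obtain d where "d > 0" and d: "\<And>y. 0 < y \<Longrightarrow> y \<noteq> x \<Longrightarrow> dist y x < d \<Longrightarrow> f y \<le> f x"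
    by (auto simp: eventually_at)
  \<comment> \<open>Half the smaller distance keeps \<open>y\<close> below \<open>b\<close> and
    inside the radius \<open>d\<close>.\<close>
  define y where "y = x + min (b - x) d / 2"
  have "x < y" "y < b" "dist y x < d"
    using \<open>d > 0\<close> \<open>x < b\<close> by (auto simp: y_def dist_real_def min_def field_simps)
  with d[of y] assms(2)[of y] \<open>0 < x\<close> show False by simp
qed

lemma not_is_mode_decreasing:
  fixes f :: "real \<Rightarrow> real"
  assumes "a < x" "\<And>y. 0 < y \<Longrightarrow> a < y \<Longrightarrow> y < x \<Longrightarrow> f x < f y"
  shows "\<not> is_mode f x"
proof
  assume "is_mode f x"
  then have "0 < x" and "\<forall>\<^sub>F y in at x within {0<..}. f y \<le> f x"
    by (auto simp: is_mode_def)
  then obtain d where "d > 0" and d: "\<And>y. 0 < y \<Longrightarrow> y \<noteq> x \<Longrightarrow> dist y x < d \<Longrightarrow> f y \<le> f x"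
    by (auto simp: eventually_at)
  \<comment> \<open>Capping the step also by \<open>x\<close> gives \<open>y\<close> \<ge>
    \<open>x / 2\<close>, so the witness stays in the support.\<close>
  define y where "y = x - min (min (x - a) x) d / 2"
  have "0 < y" "a < y" "y < x" "dist y x < d"
    using \<open>d > 0\<close> \<open>a < x\<close> \<open>0 < x\<close> by (auto simp: y_def dist_real_def min_def field_simps)
  with d[of y] assms(2)[of y] show False by simp
qed

text \<open>Left of \<open>a\<close> larger values lie to the right, and right of \<open>a\<close>
  they lie to the left, so only \<open>a\<close> survives.\<close>

lemma modes_one_peak:
  fixes f :: "real \<Rightarrow> real"
  assumes "0 < a"
    and incr: "strict_mono_on {0<..a} f"
    and decr: "strict_antimono_on {a..} f"
  shows "{t. is_mode f t} = {a}"
proof (intro equalityI subsetI)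
  fix t assume "t \<in> {t. is_mode f t}"
  then have t: "is_mode f t" "0 < t" by (auto simp: is_mode_def)
  have "\<not> t < a"
    using t not_is_mode_increasing[of t a f] strict_mono_onD[OF incr, of t] by auto
  moreover have "\<not> a < t"
    using t not_is_mode_decreasing[of a t f] monotone_onD[OF decr, of _ t] by auto
  ultimately show "t \<in> {a}" by simp
next
  fix t assume "t \<in> {a}"
  then show "t \<in> {t. is_mode f t}"
    using \<open>0 < a\<close> is_mode_peak[of a 0 "a + 1" f]
      strict_mono_onD[OF incr, of _ a] monotone_onD[OF decr, of a]
    by (fastforce intro: less_imp_le)
qed

text \<open>Neighbouring pieces share their endpoints, so each turning point can be compared with
  points on both sides.\<close>

lemma modes_two_peaks:
  fixes f :: "real \<Rightarrow> real"
  assumes "0 < a" "a < b" "b < c"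
    and incr1: "strict_mono_on {0<..a} f"
    and decr1: "strict_antimono_on {a..b} f"
    and incr2: "strict_mono_on {b..c} f"
    and decr2: "strict_antimono_on {c..} f"
  shows "{t. is_mode f t} = {a, c}" "{t. is_min_point f t} = {b}"
proof -
  note mono = strict_mono_onD[OF incr1] monotone_onD[OF decr1]
    strict_mono_onD[OF incr2] monotone_onD[OF decr2]
  show "{t. is_mode f t} = {a, c}"
  proof (intro equalityI subsetI)
    fix t assume "t \<in> {t. is_mode f t}"
    then have t: "is_mode f t" "0 < t" by (auto simp: is_mode_def)
    have "\<not> t < a" "\<not> (b \<le> t \<and> t < c)"
      using t not_is_mode_increasing[of t a f] not_is_mode_increasing[of t c f]
        mono(1)[of t] mono(3)[of t] by auto
    moreover have "\<not> (a < t \<and> t \<le> b)" "\<not> c < t"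
      using t not_is_mode_decreasing[of a t f] not_is_mode_decreasing[of c t f]
        mono(2)[of _ t] mono(4)[of _ t] by auto
    ultimately show "t \<in> {a, c}" by auto
  next
    have "is_mode f a"
      using assms(1,2) mono(1)[of _ a] mono(2)[of a]
      by (intro is_mode_peak[of a 0 b]) (auto intro: less_imp_le)
    moreover have "is_mode f c"
      using assms(1-3) mono(3)[of _ c] mono(4)[of c]
      by (intro is_mode_peak[of c b "c + 1"]) (auto intro: less_imp_le)
    ultimately show "t \<in> {t. is_mode f t}" if "t \<in> {a, c}" for t
      using that by auto
  qed
  show "{t. is_min_point f t} = {b}"
    unfolding is_min_point_iff_is_mode
  proof (intro equalityI subsetI)
    fix t assume "t \<in> {t. is_mode (\<lambda>t. - f t) t}"
    then have t: "is_mode (\<lambda>t. - f t) t" "0 < t" by (auto simp: is_mode_def)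
    \<comment> \<open>For \<open>- f\<close> all directions flip: the falling pieces of
      \<open>f\<close> rule out \<open>t\<close> from the right, the rising ones from the left.
      Beyond \<open>c\<close> the piece is unbounded, so \<open>t + 1\<close> is a safe right
      end.\<close>
    have "\<not> (a \<le> t \<and> t < b)" "\<not> c \<le> t"
      using t not_is_mode_increasing[of t b "\<lambda>t. - f t"]
        not_is_mode_increasing[of t "t + 1" "\<lambda>t. - f t"]
        mono(2)[of t] mono(4)[of t] by auto
    moreover have "\<not> t \<le> a" "\<not> (b < t \<and> t \<le> c)"
      using t assms(1-3) not_is_mode_decreasing[of 0 t "\<lambda>t. - f t"]
        not_is_mode_decreasing[of b t "\<lambda>t. - f t"] mono(1)[of _ t] mono(3)[of _ t] by auto
    ultimately show "t \<in> {b}" by auto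
  next
    have "is_mode (\<lambda>t. - f t) b"
      using assms(1-3) mono(2)[of _ b] mono(3)[of b]
      by (intro is_mode_peak[of b a c]) (auto intro: less_imp_le)
    then show "t \<in> {t. is_mode (\<lambda>t. - f t) t}" if "t \<in> {b}" for t
      using that by auto
  qed
qed

section \<open>The density as a composition\<close>

definition lbs_inner :: "real \<Rightarrow> real \<Rightarrow> real" where
  "lbs_inner \<theta> t = sqrt (t / \<theta>) + sqrt (\<theta> / t)"

text \<open>Up to a constant factor this is, for positive \<open>w\<close>, the Rayleigh density
  with scale \<alpha>, whose peak is at \<alpha>.\<close>

definition lbs_outer :: "real \<Rightarrow> real \<Rightarrow> real" where
  "lbs_outer \<alpha> w = w * exp (- (1 / (2 * \<alpha>\<^sup>2)) * (w\<^sup>2 - 4))"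

lemma lbs_inner_squared:
  assumes "\<theta> > 0" "t > 0"
  shows "(lbs_inner \<theta> t)\<^sup>2 = t / \<theta> + \<theta> / t + 2"
proof -
  \<comment> \<open>The two roots are reciprocal, so the cross term of the square is 2.\<close>
  have "sqrt (t / \<theta>) * sqrt (\<theta> / t) = 1"
    using assms by (simp flip: real_sqrt_mult)
  then show ?thesis
    using assms by (simp add: lbs_inner_def power2_sum)
qed

lemma lbs_inner_nonneg: "\<theta> > 0 \<Longrightarrow> t > 0 \<Longrightarrow> lbs_inner \<theta> t \<ge> 0"
  by (simp add: lbs_inner_def)

lemma lbs_density_eq:
  assumes "\<theta> > 0" "t > 0"
  shows "lbs_density \<alpha> \<theta> t =
    1 / (sqrt (2 * pi) * \<alpha> * \<theta> * (\<alpha>\<^sup>2 + 2)) * lbs_outer \<alpha> (lbs_inner \<theta> t)"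
  using assms by (simp add: lbs_density_def lbs_outer_def lbs_inner_squared)
    (simp add: lbs_inner_def algebra_simps)

lemma lbs_density_less_iff:
  assumes "\<alpha> > 0" "\<theta> > 0" "x > 0" "y > 0"
  shows "lbs_density \<alpha> \<theta> x < lbs_density \<alpha> \<theta> y \<longleftrightarrow>
    lbs_outer \<alpha> (lbs_inner \<theta> x) < lbs_outer \<alpha> (lbs_inner \<theta> y)"
proof -
  have "sqrt (2 * pi) * \<alpha> * \<theta> * (\<alpha>\<^sup>2 + 2) > 0"
    using assms by (intro mult_pos_pos add_nonneg_pos) auto
  then show ?thesis
    using assms by (simp only: lbs_density_eq mult_less_cancel_left_pos zero_less_divide_1_iff)
qed

section \<open>Monotonicity of the inner function on either side of \<theta>\<close>

lemma lbs_inner_less_iff: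
  assumes "\<theta> > 0" "x > 0" "y > 0"
  shows "lbs_inner \<theta> x < lbs_inner \<theta> y \<longleftrightarrow> 0 < (y - x) * (x * y - \<theta>\<^sup>2)"
proof -
  \<comment> \<open>Squaring preserves the order of nonnegative numbers and leaves a rational
    function.\<close>
  have "lbs_inner \<theta> x < lbs_inner \<theta> y \<longleftrightarrow> (lbs_inner \<theta> x)\<^sup>2 < (lbs_inner \<theta> y)\<^sup>2"
    using assms by (metis lbs_inner_nonneg power2_less_imp_less power_strict_mono zero_less_numeral)
  also have "\<dots> \<longleftrightarrow> 0 < (lbs_inner \<theta> y)\<^sup>2 - (lbs_inner \<theta> x)\<^sup>2"
    by simp
  \<comment> \<open>The factor \<open>x * y - \<theta>\<^sup>2\<close> decides the direction: for
    distinct arguments it is negative if both are at most \<theta> and positive if both are at least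
    \<theta>.\<close>
  also have "(lbs_inner \<theta> y)\<^sup>2 - (lbs_inner \<theta> x)\<^sup>2 = (y - x) * (x * y - \<theta>\<^sup>2) / (\<theta> * x * y)"
    unfolding lbs_inner_squared[OF assms(1,2)] lbs_inner_squared[OF assms(1,3)]
    using assms by (simp add: field_simps power2_eq_square)
  also have "0 < \<dots> \<longleftrightarrow> 0 < (y - x) * (x * y - \<theta>\<^sup>2)"
    using assms by (intro zero_less_divide_iff[THEN trans]) (auto simp: not_less mult_less_0_iff)
  finally show ?thesis .
qed

lemma strict_antimono_on_lbs_inner:
  assumes "\<theta> > 0"
  shows "strict_antimono_on {0<..\<theta>} (lbs_inner \<theta>)"
proof (rule monotone_onI)
  fix x y assume xy: "x \<in> {0<..\<theta>}" "y \<in> {0<..\<theta>}" "x < y"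
  then have "x * y < \<theta> * \<theta>"
    by (intro mult_less_le_imp_less) auto
  then show "lbs_inner \<theta> x > lbs_inner \<theta> y"
    using xy assms by (simp add: lbs_inner_less_iff power2_eq_square mult.commute mult_neg_neg)
qed

lemma strict_mono_on_lbs_inner:
  assumes "\<theta> > 0"
  shows "strict_mono_on {\<theta>..} (lbs_inner \<theta>)"
proof (rule strict_mono_onI)
  fix x y assume xy: "x \<in> {\<theta>..}" "y \<in> {\<theta>..}" "x < y"
  then have "\<theta> * \<theta> < x * y"
    using assms by (intro mult_le_less_imp_less) auto
  then show "lbs_inner \<theta> x < lbs_inner \<theta> y"
    using xy assms by (simp add: lbs_inner_less_iff power2_eq_square)
qed

lemma lbs_inner_at_scale: "\<theta> > 0 \<Longrightarrow> lbs_inner \<theta> \<theta> = 2"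
  by (simp add: lbs_inner_def)

section \<open>Monotonicity of the outer function on either side of \<alpha>\<close>

lemma has_derivative_lbs_outer:
  assumes "\<alpha> > 0"
  shows "(lbs_outer \<alpha> has_real_derivative
    exp (- (1 / (2 * \<alpha>\<^sup>2)) * (w\<^sup>2 - 4)) * (1 - w\<^sup>2 / \<alpha>\<^sup>2)) (at w)"
  unfolding lbs_outer_def using assms
  by (auto intro!: derivative_eq_intros simp: field_simps power2_eq_square)

lemma strict_mono_on_lbs_outer:
  assumes "\<alpha> > 0"
  shows "strict_mono_on {0..\<alpha>} (lbs_outer \<alpha>)"
proof (rule strict_mono_onI)
  fix x y assume xy: "x \<in> {0..\<alpha>}" "y \<in> {0..\<alpha>}" "x < y"
  show "lbs_outer \<alpha> x < lbs_outer \<alpha> y"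
  \<comment> \<open>The derivative vanishes at \<alpha>, which \<open>y\<close> may equal; the open
    version asks for a sign only strictly between \<open>x\<close> and \<open>y\<close>.\<close>
  proof (rule DERIV_pos_imp_increasing_open[OF \<open>x < y\<close>])
    fix w assume "x < w" "w < y"
    then have "w\<^sup>2 < \<alpha>\<^sup>2"
      using xy by (intro power_strict_mono) auto
    then have "0 < exp (- (1 / (2 * \<alpha>\<^sup>2)) * (w\<^sup>2 - 4)) * (1 - w\<^sup>2 / \<alpha>\<^sup>2)"
      using assms by (intro mult_pos_pos) auto
    then show "\<exists>d. (lbs_outer \<alpha> has_real_derivative d) (at w) \<and> 0 < d"
      using has_derivative_lbs_outer[OF assms] by blast
  next
    show "continuous_on {x..y} (lbs_outer \<alpha>)"
      by (meson DERIV_continuous_on has_derivative_lbs_outer[OF assms] has_field_derivative_at_within)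
  qed
qed

lemma strict_antimono_on_lbs_outer:
  assumes "\<alpha> > 0"
  shows "strict_antimono_on {\<alpha>..} (lbs_outer \<alpha>)"
proof (rule monotone_onI)
  fix x y assume xy: "x \<in> {\<alpha>..}" "y \<in> {\<alpha>..}" "x < y"
  show "lbs_outer \<alpha> x > lbs_outer \<alpha> y"
  proof (rule DERIV_neg_imp_decreasing_open[OF \<open>x < y\<close>])
    fix w assume "x < w" "w < y"
    then have "\<alpha>\<^sup>2 < w\<^sup>2"
      using xy assms by (intro power_strict_mono) auto
    then have "exp (- (1 / (2 * \<alpha>\<^sup>2)) * (w\<^sup>2 - 4)) * (1 - w\<^sup>2 / \<alpha>\<^sup>2) < 0"
      using assms by (intro mult_pos_neg) auto
    then show "\<exists>d. (lbs_outer \<alpha> has_real_derivative d) (at w) \<and> d < 0"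
      using has_derivative_lbs_outer[OF assms] by blast
  next
    show "continuous_on {x..y} (lbs_outer \<alpha>)"
      by (meson DERIV_continuous_on has_derivative_lbs_outer[OF assms] has_field_derivative_at_within)
  qed
qed

section \<open>Shape of the density\<close>

lemma lbs_density_monotone_on_inner:
  assumes "\<alpha> > 0" "\<theta> > 0" "A \<subseteq> {0<..}"
  shows
    "strict_mono_on A (lbs_inner \<theta>) \<Longrightarrow> (\<And>t. t \<in> A \<Longrightarrow> lbs_inner \<theta> t \<le> \<alpha>) \<Longrightarrow>
      strict_mono_on A (lbs_density \<alpha> \<theta>)"
    "strict_mono_on A (lbs_inner \<theta>) \<Longrightarrow> (\<And>t. t \<in> A \<Longrightarrow> lbs_inner \<theta> t \<ge> \<alpha>) \<Longrightarrow>
      strict_antimono_on A (lbs_density \<alpha> \<theta>)"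
    "strict_antimono_on A (lbs_inner \<theta>) \<Longrightarrow> (\<And>t. t \<in> A \<Longrightarrow> lbs_inner \<theta> t \<le> \<alpha>) \<Longrightarrow>
      strict_antimono_on A (lbs_density \<alpha> \<theta>)"
    "strict_antimono_on A (lbs_inner \<theta>) \<Longrightarrow> (\<And>t. t \<in> A \<Longrightarrow> lbs_inner \<theta> t \<ge> \<alpha>) \<Longrightarrow>
      strict_mono_on A (lbs_density \<alpha> \<theta>)"
  \<comment> \<open>Directions compose like signs. Inner values are nonnegative, so those at most
    \<alpha> lie in the interval where \<open>lbs_outer\<close> is known to rise.\<close>
  unfolding monotone_on_def
  using assms strict_mono_onD[OF strict_mono_on_lbs_outer[OF assms(1)]]
    monotone_onD[OF strict_antimono_on_lbs_outer[OF assms(1)]] lbs_inner_nonneg[OF assms(2)]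
  by (auto simp: lbs_density_less_iff subset_iff)

lemma modes_lbs_density_le_2:
  assumes "\<alpha> > 0" "\<theta> > 0" "\<alpha> \<le> 2"
  shows "{t. is_mode (lbs_density \<alpha> \<theta>) t} = {\<theta>}"
proof (rule modes_one_peak[OF \<open>\<theta> > 0\<close>])
  note anti = strict_antimono_on_lbs_inner[OF assms(2)]
  note mono = strict_mono_on_lbs_inner[OF assms(2)]
  \<comment> \<open>Both branches are compared with the minimum value 2 at \<theta>, which is at
    least \<alpha>.\<close>
  have "lbs_inner \<theta> t \<ge> \<alpha>" if "t > 0" for t
    using that assms monotone_onD[OF anti, of t \<theta>] strict_mono_onD[OF mono, of \<theta> t]
      lbs_inner_at_scale[of \<theta>] by (cases t \<theta> rule: linorder_cases) auto
  then show "strict_mono_on {0<..\<theta>} (lbs_density \<alpha> \<theta>)"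
    "strict_antimono_on {\<theta>..} (lbs_density \<alpha> \<theta>)"
    using assms anti mono by (auto intro!: lbs_density_monotone_on_inner(2,4))
qed

text \<open>The quadratic is the equation
  \<open>t / \<theta> + \<theta> / t + 2 = \<alpha>\<^sup>2\<close> with denominators cleared;
  nonnegativity then allows taking roots.\<close>

lemma lbs_inner_eqI:
  assumes "\<alpha> > 0" "\<theta> > 0" "t > 0" "t\<^sup>2 + \<theta>\<^sup>2 = (\<alpha>\<^sup>2 - 2) * \<theta> * t"
  shows "lbs_inner \<theta> t = \<alpha>"
proof -
  have "(lbs_inner \<theta> t)\<^sup>2 = (t\<^sup>2 + \<theta>\<^sup>2) / (\<theta> * t) + 2"
    unfolding lbs_inner_squared[OF assms(2,3)]
    using assms(2,3) by (simp add: field_simps power2_eq_square)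
  also have "\<dots> = \<alpha>\<^sup>2"
    unfolding assms(4) using assms(2,3) by simp
  finally show ?thesis
    using assms lbs_inner_nonneg[of \<theta> t] by (simp add: power2_eq_iff_nonneg)
qed

text \<open>The points \<open>a\<close>, \<theta>, \<open>c\<close> cut the half-line into four
  pieces. On each, the inner function has a fixed direction and stays on one side of the level
  \<alpha>, which fixes the direction of the density.\<close>

lemma extrema_lbs_density_gt_2:
  assumes "\<alpha> > 2" "\<theta> > 0" "0 < a" "a < \<theta>" "\<theta> < c"
    and "lbs_inner \<theta> a = \<alpha>" "lbs_inner \<theta> c = \<alpha>"
  shows "{t. is_mode (lbs_density \<alpha> \<theta>) t} = {a, c}"
    "{t. is_min_point (lbs_density \<alpha> \<theta>) t} = {\<theta>}"
proof -
  have "\<alpha> > 0" using assms(1) by simp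
  note anti = strict_antimono_on_lbs_inner[OF assms(2)]
  note mono = strict_mono_on_lbs_inner[OF assms(2)]
  have inner_left: "\<alpha> \<le> lbs_inner \<theta> t" if "0 < t" "t \<le> a" for t
    using that assms monotone_onD[OF anti, of t a] by (cases "t = a") auto
  have inner_right: "\<alpha> \<le> lbs_inner \<theta> t" if "c \<le> t" for t
    using that assms strict_mono_onD[OF mono, of c t] by (cases "t = c") auto
  have inner_mid_left: "lbs_inner \<theta> t \<le> \<alpha>" if "a \<le> t" "t \<le> \<theta>" for t
    using that assms monotone_onD[OF anti, of a t] by (cases "t = a") auto
  have inner_mid_right: "lbs_inner \<theta> t \<le> \<alpha>" if "\<theta> \<le> t" "t \<le> c" for t
    using that assms strict_mono_onD[OF mono, of t c] by (cases "t = c") auto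
  have "strict_mono_on {0<..a} (lbs_density \<alpha> \<theta>)"
    using assms \<open>\<alpha> > 0\<close> inner_left
    by (intro lbs_density_monotone_on_inner(4) monotone_on_subset[OF anti]) auto
  moreover have "strict_antimono_on {a..\<theta>} (lbs_density \<alpha> \<theta>)"
    using assms \<open>\<alpha> > 0\<close> inner_mid_left
    by (intro lbs_density_monotone_on_inner(3) monotone_on_subset[OF anti]) auto
  moreover have "strict_mono_on {\<theta>..c} (lbs_density \<alpha> \<theta>)"
    using assms \<open>\<alpha> > 0\<close> inner_mid_right
    by (intro lbs_density_monotone_on_inner(1) monotone_on_subset[OF mono]) auto
  moreover have "strict_antimono_on {c..} (lbs_density \<alpha> \<theta>)"
    using assms \<open>\<alpha> > 0\<close> inner_right
    by (intro lbs_density_monotone_on_inner(2) monotone_on_subset[OF mono]) auto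
  ultimately show "{t. is_mode (lbs_density \<alpha> \<theta>) t} = {a, c}"
    "{t. is_min_point (lbs_density \<alpha> \<theta>) t} = {\<theta>}"
    using modes_two_peaks[OF assms(3-5)] by blast+
qed

section \<open>The explicit modes as roots of a quadratic\<close>

theorem theorem2p2:
  fixes \<alpha> \<theta> :: real
  assumes "\<alpha> > 0" and "\<theta> > 0"
  defines "f \<equiv> lbs_density \<alpha> \<theta>"
    and "t_minus \<equiv> \<theta> / 2 * ((\<alpha>\<^sup>2 - 2) - \<alpha> * sqrt ((\<alpha> - 2) * (\<alpha> + 2)))"
    and "t_plus \<equiv> \<theta> / 2 * ((\<alpha>\<^sup>2 - 2) + \<alpha> * sqrt ((\<alpha> - 2) * (\<alpha> + 2)))"
  shows "(\<alpha> \<le> 2 \<longrightarrow> unimodal f \<and> is_mode f \<theta>) \<and>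
         (\<alpha> > 2 \<longrightarrow>
            bimodal f \<and> {t. is_mode f t} = {t_minus, t_plus} \<and>
            {t. is_min_point f t} = {\<theta>} \<and> t_minus < \<theta> \<and> \<theta> < t_plus)"
proof (intro conjI[of "_ \<longrightarrow> _"] impI)
  assume "\<alpha> \<le> 2"
  then have "{t. is_mode f t} = {\<theta>}"
    unfolding f_def using assms(1,2) by (intro modes_lbs_density_le_2)
  then show "unimodal f \<and> is_mode f \<theta>"
    by (auto simp: unimodal_def)
next
  assume "\<alpha> > 2"
  \<comment> \<open>The quadratic \<open>t\<^sup>2 - (\<alpha>\<^sup>2 - 2) * \<theta> * t +
    \<theta>\<^sup>2\<close> has discriminant
    \<open>(\<theta> * \<alpha> * s)\<^sup>2\<close>.\<close>
  define s where "s = sqrt ((\<alpha> - 2) * (\<alpha> + 2))"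
  have "(\<alpha> - 2) * (\<alpha> + 2) > 0"
    using \<open>\<alpha> > 2\<close> by simp
  then have "s > 0" and "s\<^sup>2 = (\<alpha> - 2) * (\<alpha> + 2)"
    unfolding s_def by (simp_all only: real_sqrt_gt_zero real_sqrt_pow2 less_imp_le)
  then have s2: "s\<^sup>2 = \<alpha>\<^sup>2 - 4"
    by (simp add: power2_eq_square algebra_simps)
  \<comment> \<open>From here on the roots enter mostly through their sum and product.\<close>
  have sum: "t_minus + t_plus = (\<alpha>\<^sup>2 - 2) * \<theta>"
    by (simp add: t_minus_def t_plus_def algebra_simps)
  have "t_minus * t_plus = (\<theta> / 2)\<^sup>2 * ((\<alpha>\<^sup>2 - 2)\<^sup>2 - \<alpha>\<^sup>2 * s\<^sup>2)"
    unfolding t_minus_def t_plus_def s_def[symmetric] by (simp add: power2_eq_square algebra_simps)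
  \<comment> \<open>With \<open>s\<^sup>2 = \<alpha>\<^sup>2 - 4\<close> the second factor collapses
    to 4.\<close>
  then have prod: "t_minus * t_plus = \<theta>\<^sup>2"
    unfolding s2 by (simp add: power2_eq_square algebra_simps)
  have less: "t_minus < t_plus"
    using assms(1,2) \<open>s > 0\<close> by (simp add: t_minus_def t_plus_def s_def[symmetric])
  have "\<alpha>\<^sup>2 > 2"
    using \<open>\<alpha> > 2\<close> power_strict_mono[of 2 \<alpha> 2] by simp
  then have "t_plus > 0"
    unfolding t_plus_def s_def[symmetric]
    using assms(1,2) \<open>s > 0\<close> by (intro mult_pos_pos add_pos_pos) auto
  \<comment> \<open>The formula for \<open>t_minus\<close> is a difference, so its sign is read off
    from the positive product.\<close>
  moreover from this have "t_minus > 0"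
    using prod assms(2) by (metis zero_less_mult_pos2 zero_less_power)
  \<comment> \<open>Two distinct positive numbers with product \<open>\<theta>\<^sup>2\<close> lie
    strictly on either side of \<theta>.\<close>
  moreover have "t_minus < \<theta>"
  proof (rule ccontr)
    assume "\<not> t_minus < \<theta>"
    then have "\<theta> * \<theta> < t_minus * t_plus"
      using less assms(2) by (intro mult_le_less_imp_less) auto
    then show False using prod by (simp add: power2_eq_square)
  qed
  moreover have "\<theta> < t_plus"
  proof (rule ccontr)
    assume "\<not> \<theta> < t_plus"
    then have "t_minus * t_plus < \<theta> * \<theta>"
      using less \<open>t_plus > 0\<close> \<open>t_minus > 0\<close> by (intro mult_less_le_imp_less) auto
    then show False using prod by (simp add: power2_eq_square)
  qed
  \<comment> \<open>Vieta backwards: with sum and product put in, both sides are the same polynomial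
    in the two roots.\<close>
  moreover have "t_minus\<^sup>2 + \<theta>\<^sup>2 = (\<alpha>\<^sup>2 - 2) * \<theta> * t_minus"
    "t_plus\<^sup>2 + \<theta>\<^sup>2 = (\<alpha>\<^sup>2 - 2) * \<theta> * t_plus"
    unfolding sum[symmetric] prod[symmetric] by (simp_all add: power2_eq_square algebra_simps)
  moreover from this have "lbs_inner \<theta> t_minus = \<alpha>" "lbs_inner \<theta> t_plus = \<alpha>"
    using assms(1,2) \<open>t_minus > 0\<close> \<open>t_plus > 0\<close>
    by (auto intro: lbs_inner_eqI)
  ultimately have "{t. is_mode f t} = {t_minus, t_plus}" "{t. is_min_point f t} = {\<theta>}"
    unfolding f_def using extrema_lbs_density_gt_2[OF \<open>\<alpha> > 2\<close> \<open>\<theta> > 0\<close>] by blast+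
  then show "bimodal f \<and> {t. is_mode f t} = {t_minus, t_plus} \<and>
      {t. is_min_point f t} = {\<theta>} \<and> t_minus < \<theta> \<and> \<theta> < t_plus"
    \<comment> \<open>\<open>less\<close> makes the two modes distinct, so their set has cardinality
      2.\<close>
    using less \<open>t_minus < \<theta>\<close> \<open>\<theta> < t_plus\<close> by (simp add: bimodal_def)
qed

end
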